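(* Let $K$ be a field and let $a=(a_1,a_2)$, $a'=(a'_1,a'_2)$, $b'=(b'_1,b'_2)$, $b=(b_1,b_2)$ in $\mathbb{N}^2$ satisfy $a_i<a'_i<b'_i<b_i$ for $i=1,2$. Let $\mathcal{P}=\mathcal{P}_{(a,b)}\setminus\mathcal{P}_{(a',b')}$ be the polyomino consisting of all cells contained in the interval $[a,b]$ that are not contained in the interval $[a',b']$. Let $I_{\mathcal{P}}\subset S=K[x_v : v\in V(\mathcal{P})]$ be the polyomino ideal of $\mathcal{P}$, and let $J_{\mathcal{P}}=\ker\varphi$, where $\varphi:S\to K[r_{a_1},\ldots,r_{b_1},s_{a_2},\ldots,s_{b_2},t_1,\ldots,t_M]$ is the $K$-algebra homomorphism with $\varphi(x_v)=r_{v_1}s_{v_2}t_{\mu(v)}$ for every $v=(v_1,v_2)\in V(\mathcal{P})$. Here $\mu$ is the labelling of $V(\mathcal{P})$ defined in the context and $M=\max\{\mu(v): v\in V(\mathcal{P})\}$. Then $I_{\mathcal{P}}=J_{\mathcal{P}}$.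
   Context: For $a=(i,j)$ and $b=(k,l)$ in $\mathbb{N}^2$ write $a\le b$ if $i\le k$ and $j\le l$. The interval $[a,b]$ is the set $\{c\in\mathbb{N}^2 : a\le c\le b\}$. A cell is an interval of the form $C=[c,c+(1,1)]$ with $c\in\mathbb{N}^2$. Its vertices are $c$, $c+(1,0)$, $c+(0,1)$, $c+(1,1)$, and the set of these is $V(C)$. Its edges are $\{c,c+(1,0)\}$, $\{c,c+(0,1)\}$, $\{c+(1,0),c+(1,1)\}$, $\{c+(0,1),c+(1,1)\}$. A polyomino is a finite collection $\mathcal{P}$ of cells such that any two cells $C,D\in\mathcal{P}$ are connected by a sequence $C=C_1,\ldots,C_m=D$ of cells of $\mathcal{P}$ with $C_i\cap C_{i+1}$ an edge of $C_i$ for $i=1,\ldots,m-1$. The vertex set of $\mathcal{P}$ is $V(\mathcal{P})=\bigcup_{C\in\mathcal{P}}V(C)$. For an interval $[a,b]$, $\mathcal{P}_{(a,b)}$ denotes the collection of all cells contained in $[a,b]$. Polyomino ideal: let $S=K[x_v : v\in V(\mathcal{P})]$ be the polynomial ring over the field $K$, and write $x_{ij}=x_v$ for $v=(i,j)$. For $i<k$ and $j<l$, the binomial $x_{ij}x_{kl}-x_{il}x_{kj}$ is called an inner minor of $\mathcal{P}$ if all cells $[(r,s),(r+1,s+1)]$ with $i\le r\le k-1$ and $j\le s\le l-1$ belong to $\mathcal{P}$. The polyomino ideal $I_{\mathcal{P}}\subset S$ is the ideal generated by all inner minors of $\mathcal{P}$. Labelling: for $\mathcal{P}=\mathcal{P}_{(a,b)}\setminus\mathcal{P}_{(a',b')}$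 with $a_i<a'_i<b'_i<b_i$ for $i=1,2$, the map $\mu:V(\mathcal{P})\to\mathbb{Z}$ is defined for $v=(v_1,v_2)\in V(\mathcal{P})$ by: - $\mu(v)=1$ if $a_1\le v_1\le a'_1$ and $a_2\le v_2\le a'_2$; - $\mu(v)=1$ if $b'_1\le v_1\le b_1$ and $b'_2\le v_2\le b_2$; - $\mu(v)=2$ if $a_1\le v_1\le a'_1$ and $b'_2\le v_2\le b_2$; - $\mu(v)=2$ if $b'_1\le v_1\le b_1$ and $a_2\le v_2\le a'_2$; - $\mu(v)=v_1-a'_1+2$ if $a'_1<v_1<b'_1$ and $a_2\le v_2\le a'_2$; - $\mu(v)=v_2-a'_2+(b'_1-a'_1)+1$ if $b'_1\le v_1\le b_1$ and $a'_2<v_2<b'_2$; - $\mu(v)=b'_1-v_1+(b'_1-a'_1)+(b'_2-a'_2)$ if $a'_1<v_1<b'_1$ and $b'_2\le v_2\le b_2$; - $\mu(v)=b'_2-v_2+2(b'_1-a'_1)+(b'_2-a'_2)-1$ if $a_1\le v_1\le a'_1$ and $a'_2<v_2<b'_2$. *)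

theory Defs
  imports "HOL-Library.Poly_Mapping" "HOL-Library.Product_Plus" "HOL-Library.Product_Order"
    "HOL-Algebra.Ideal" "HOL-Algebra.RingHom"
begin

section \<open>Polyominoes\<close>

text \<open>The order on \<^typ>\<open>nat \<times> nat\<close> is the componentwise one of \<^theory>\<open>HOL-Library.Product_Order\<close>,
  so \<open>{a..b}\<close> is the interval \<open>[a,b]\<close> of lattice points.\<close>

definition cell :: "nat \<times> nat \<Rightarrow> (nat \<times> nat) set" where
  "cell c = {c..c + (1, 1)}"

definition is_cell :: "(nat \<times> nat) set \<Rightarrow> bool" where
  "is_cell C \<longleftrightarrow> (\<exists>c. C = cell c)"

definition cell_vertices :: "nat \<times> nat \<Rightarrow> (nat \<times> nat) set" where
  "cell_vertices c = {c, c + (1, 0), c + (0, 1), c + (1, 1)}"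

definition cell_edges :: "nat \<times> nat \<Rightarrow> (nat \<times> nat) set set" where
  "cell_edges c = {{c, c + (1, 0)}, {c, c + (0, 1)},
                   {c + (1, 0), c + (1, 1)}, {c + (0, 1), c + (1, 1)}}"

definition vertex_set :: "(nat \<times> nat) set set \<Rightarrow> (nat \<times> nat) set" where
  "vertex_set P = (\<Union>c \<in> {c. cell c \<in> P}. cell_vertices c)"

definition adjacent_cells :: "(nat \<times> nat) set set \<Rightarrow> ((nat \<times> nat) set \<times> (nat \<times> nat) set) set" where
  "adjacent_cells P = {(C, D). C \<in> P \<and> D \<in> P \<and> (\<exists>c. C = cell c \<and> C \<inter> D \<in> cell_edges c)}"

definition polyomino :: "(nat \<times> nat) set set \<Rightarrow> bool" where
  "polyomino P \<longleftrightarrow> finite P \<and> (\<forall>C\<in>P. is_cell C) \<and>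
     (\<forall>C\<in>P. \<forall>D\<in>P. (C, D) \<in> (adjacent_cells P)\<^sup>*)"

definition cells_in :: "nat \<times> nat \<Rightarrow> nat \<times> nat \<Rightarrow> (nat \<times> nat) set set" where
  "cells_in a b = {C. is_cell C \<and> C \<subseteq> {a..b}}"

lemma cell_eq: "cell (i, j) = {(i, j), (i + 1, j), (i, j + 1), (i + 1, j + 1)}"
  by (auto simp: cell_def less_eq_prod_def)

lemma cell_vertices_eq: "cell_vertices c = cell c"
  by (cases c) (auto simp: cell_eq cell_vertices_def)

lemma cell_inject: "cell c = cell d \<longleftrightarrow> c = d"
  by (cases c; cases d) (auto simp: cell_def Icc_eq_Icc)

lemma cell_in_cells_in:
  "cell (i, j) \<in> cells_in a b \<longleftrightarrow> fst a \<le> i \<and> i < fst b \<and> snd a \<le> j \<and> j < snd b"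
  by (cases a; cases b) (auto simp: cells_in_def is_cell_def cell_eq less_eq_prod_def)


section \<open>Polynomial rings\<close>

text \<open>Polynomials in indeterminates from \<^typ>\<open>'v\<close> are finitely supported maps from exponent vectors
  to coefficients; \<open>poly_ring V\<close> is the polynomial ring in the indeterminates from \<open>V\<close> only.\<close>

type_synonym ('v, 'k) mpoly = "('v \<Rightarrow>\<^sub>0 nat) \<Rightarrow>\<^sub>0 'k"

definition indet :: "'v \<Rightarrow> ('v, 'k::comm_ring_1) mpoly" where
  "indet v = Poly_Mapping.single (Poly_Mapping.single v 1) 1"

definition scalar :: "'k \<Rightarrow> ('v, 'k::comm_ring_1) mpoly" where
  "scalar c = Poly_Mapping.single 0 c"

definition poly_ring :: "'v set \<Rightarrow> ('v, 'k::comm_ring_1) mpoly ring" where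
  "poly_ring V =
     \<lparr>carrier = {p. \<forall>m\<in>Poly_Mapping.keys p. Poly_Mapping.keys m \<subseteq> V},
      monoid.mult = (*), one = 1, ring.zero = 0, add = (+)\<rparr>"

definition algebra_hom ::
  "'v set \<Rightarrow> 'w set \<Rightarrow> (('v, 'k::comm_ring_1) mpoly \<Rightarrow> ('w, 'k) mpoly) set" where
  "algebra_hom V W = {h \<in> ring_hom (poly_ring V) (poly_ring W). \<forall>c. h (scalar c) = scalar c}"


section \<open>The two ideals\<close>

definition inner_minors :: "(nat \<times> nat) set set \<Rightarrow> (nat \<times> nat, 'k::comm_ring_1) mpoly set" where
  "inner_minors P =
     {indet (i, j) * indet (k, l) - indet (i, l) * indet (k, j) | i j k l.
        i < k \<and> j < l \<and>
        (\<forall>r s. i \<le> r \<and> r \<le> k - 1 \<and> j \<le> s \<and> s \<le> l - 1 \<longrightarrow> cell (r, s) \<in> P)}"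

definition polyomino_ideal :: "(nat \<times> nat) set set \<Rightarrow> (nat \<times> nat, 'k::comm_ring_1) mpoly set" where
  "polyomino_ideal P = Idl\<^bsub>poly_ring (vertex_set P)\<^esub> (inner_minors P)"

text \<open>The labelling \<open>\<mu>\<close>; the cases are mutually exclusive if \<open>a' < b'\<close> in both coordinates, and
  exhaust the vertices of the polyomino.\<close>

definition label ::
  "nat \<times> nat \<Rightarrow> nat \<times> nat \<Rightarrow> nat \<times> nat \<Rightarrow> nat \<times> nat \<Rightarrow> nat \<times> nat \<Rightarrow> int" where
  "label a a' b' b v =
    (let a1 = int (fst a); a2 = int (snd a); a1' = int (fst a'); a2' = int (snd a');
         b1' = int (fst b'); b2' = int (snd b'); b1 = int (fst b); b2 = int (snd b);
         v1 = int (fst v); v2 = int (snd v)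
     in
      if a1 \<le> v1 \<and> v1 \<le> a1' \<and> a2 \<le> v2 \<and> v2 \<le> a2' then 1
      else if b1' \<le> v1 \<and> v1 \<le> b1 \<and> b2' \<le> v2 \<and> v2 \<le> b2 then 1
      else if a1 \<le> v1 \<and> v1 \<le> a1' \<and> b2' \<le> v2 \<and> v2 \<le> b2 then 2
      else if b1' \<le> v1 \<and> v1 \<le> b1 \<and> a2 \<le> v2 \<and> v2 \<le> a2' then 2
      else if a1' < v1 \<and> v1 < b1' \<and> a2 \<le> v2 \<and> v2 \<le> a2' then v1 - a1' + 2
      else if b1' \<le> v1 \<and> v1 \<le> b1 \<and> a2' < v2 \<and> v2 < b2' then v2 - a2' + (b1' - a1') + 1
      else if a1' < v1 \<and> v1 < b1' \<and> b2' \<le> v2 \<and> v2 \<le> b2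
        then b1' - v1 + (b1' - a1') + (b2' - a2')
      else if a1 \<le> v1 \<and> v1 \<le> a1' \<and> a2' < v2 \<and> v2 < b2'
        then b2' - v2 + 2 * (b1' - a1') + (b2' - a2') - 1
      else undefined)"

datatype toric_var = R nat | S nat | T int

definition toric_vars :: "nat \<times> nat \<Rightarrow> nat \<times> nat \<Rightarrow> int \<Rightarrow> toric_var set" where
  "toric_vars a b M = R ` {fst a..fst b} \<union> S ` {snd a..snd b} \<union> T ` {1..M}"


section \<open>The polyomino property\<close>

lemma ring_polyomino_cell_iff:
  "cell (i, j) \<in> cells_in a b - cells_in a' b' \<longleftrightarrow>
     fst a \<le> i \<and> i < fst b \<and> snd a \<le> j \<and> j < snd b \<and>
     \<not> (fst a' \<le> i \<and> i < fst b' \<and> snd a' \<le> j \<and> j < snd b')"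
  by (auto simp: cell_in_cells_in)

lemma adjacent_right:
  assumes "cell (i, j) \<in> P" "cell (i + 1, j) \<in> P"
  shows "(cell (i, j), cell (i + 1, j)) \<in> adjacent_cells P"
proof -
  have "cell (i, j) \<inter> cell (i + 1, j) = {(i, j) + (1, 0), (i, j) + (1, 1)}"
    by (auto simp: cell_eq)
  then have "cell (i, j) \<inter> cell (i + 1, j) \<in> cell_edges (i, j)"
    by (simp add: cell_edges_def)
  then show ?thesis using assms unfolding adjacent_cells_def by blast
qed

lemma adjacent_up:
  assumes "cell (i, j) \<in> P" "cell (i, j + 1) \<in> P"
  shows "(cell (i, j), cell (i, j + 1)) \<in> adjacent_cells P"
proof -
  have "cell (i, j) \<inter> cell (i, j + 1) = {(i, j) + (0, 1), (i, j) + (1, 1)}"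
    by (auto simp: cell_eq)
  then have "cell (i, j) \<inter> cell (i, j + 1) \<in> cell_edges (i, j)"
    by (simp add: cell_edges_def)
  then show ?thesis using assms unfolding adjacent_cells_def by blast
qed

lemma sym_adjacent_cells: "sym (adjacent_cells P)" if "\<forall>C\<in>P. is_cell C"
proof (rule symI)
  fix C D assume *: "(C, D) \<in> adjacent_cells P"
  then obtain i j where C: "C = cell (i, j)" and e: "C \<inter> D \<in> cell_edges (i, j)"
    and P: "C \<in> P" "D \<in> P"
    by (auto simp: adjacent_cells_def)
  from P that obtain k l where D: "D = cell (k, l)" by (metis is_cell_def surj_pair)
  have "C \<inter> D = {(i, j), (i + 1, j)} \<or> C \<inter> D = {(i, j), (i, j + 1)} \<or>
      C \<inter> D = {(i + 1, j), (i + 1, j + 1)} \<or> C \<inter> D = {(i, j + 1), (i + 1, j + 1)}"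
    using e by (simp add: cell_edges_def)
  then consider "C \<inter> D = {(i, j), (i + 1, j)}" | "C \<inter> D = {(i, j), (i, j + 1)}"
    | "C \<inter> D = {(i + 1, j), (i + 1, j + 1)}" | "C \<inter> D = {(i, j + 1), (i + 1, j + 1)}"
    by blast
  then have "C \<inter> D \<in> cell_edges (k, l)"
  proof cases
    case 1
    then have "(i, j) \<in> D" "(i + 1, j) \<in> D" by blast+
    then have "k = i \<and> (l = j \<or> j = l + 1)" unfolding D cell_eq by simp linarith
    then show ?thesis unfolding 1 by (elim conjE disjE) (simp_all add: cell_edges_def)
  next
    case 2
    then have "(i, j) \<in> D" "(i, j + 1) \<in> D" by blast+
    then have "l = j \<and> (k = i \<or> i = k + 1)" unfolding D cell_eq by simp linarith
    then show ?thesis unfolding 2 by (elim conjE disjE) (simp_all add: cell_edges_def)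
  next
    case 3
    then have "(i + 1, j) \<in> D" "(i + 1, j + 1) \<in> D" by blast+
    then have "l = j \<and> (k = i + 1 \<or> k = i)" unfolding D cell_eq by simp linarith
    then show ?thesis unfolding 3 by (elim conjE disjE) (simp_all add: cell_edges_def)
  next
    case 4
    then have "(i, j + 1) \<in> D" "(i + 1, j + 1) \<in> D" by blast+
    then have "k = i \<and> (l = j + 1 \<or> l = j)" unfolding D cell_eq by simp linarith
    then show ?thesis unfolding 4 by (elim conjE disjE) (simp_all add: cell_edges_def)
  qed
  then show "(D, C) \<in> adjacent_cells P"
    using P D by (auto simp: adjacent_cells_def Int_commute)
qed

lemma connected_row:
  assumes "\<And>r. i \<le> r \<Longrightarrow> r \<le> i + n \<Longrightarrow> cell (r, j) \<in> P"
  shows "(cell (i, j), cell (i + n, j)) \<in> (adjacent_cells P)\<^sup>*"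
  using assms
proof (induction n)
  case (Suc n)
  have "(cell (i + n, j), cell (i + n + 1, j)) \<in> adjacent_cells P"
    by (rule adjacent_right) (auto intro: Suc.prems)
  with Suc show ?case by (simp add: rtrancl.rtrancl_into_rtrancl)
qed simp

lemma connected_col:
  assumes "\<And>s. j \<le> s \<Longrightarrow> s \<le> j + n \<Longrightarrow> cell (i, s) \<in> P"
  shows "(cell (i, j), cell (i, j + n)) \<in> (adjacent_cells P)\<^sup>*"
  using assms
proof (induction n)
  case (Suc n)
  have "(cell (i, j + n), cell (i, j + n + 1)) \<in> adjacent_cells P"
    by (rule adjacent_up) (auto intro: Suc.prems)
  with Suc show ?case by (simp add: rtrancl.rtrancl_into_rtrancl)
qed simp

lemma polyomino_ring:
  assumes "fst a < fst a'" "fst a' < fst b'" "fst b' < fst b"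
    and "snd a < snd a'" "snd a' < snd b'" "snd b' < snd b"
  shows "polyomino (cells_in a b - cells_in a' b')"
proof -
  define P where "P = cells_in a b - cells_in a' b'"
  note iff = ring_polyomino_cell_iff[of _ _ a b a' b', folded P_def]
  have fin: "finite P"
  proof -
    have "P \<subseteq> Pow {a..b}" by (auto simp: P_def cells_in_def)
    moreover have "{a..b} \<subseteq> {fst a..fst b} \<times> {snd a..snd b}"
      by (auto simp: less_eq_prod_def)
    then have "finite {a..b}" by (rule finite_subset) auto
    ultimately show ?thesis by (auto intro: finite_subset)
  qed
  have cells: "\<forall>C\<in>P. is_cell C" by (auto simp: P_def cells_in_def)
  let ?A = "(adjacent_cells P)\<^sup>*"
  have sym: "sym ?A" by (intro sym_rtrancl sym_adjacent_cells cells)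
  note symD = symD[OF sym]
  have row: "(cell (i, j), cell (k, j)) \<in> ?A"
    if "i \<le> k" "\<And>r. i \<le> r \<Longrightarrow> r \<le> k \<Longrightarrow> cell (r, j) \<in> P" for i j k
    using connected_row[of i "k - i" j P] that by simp
  have col: "(cell (i, j), cell (i, l)) \<in> ?A"
    if "j \<le> l" "\<And>s. j \<le> s \<Longrightarrow> s \<le> l \<Longrightarrow> cell (i, s) \<in> P" for i j l
    using connected_col[of j "l - j" i P] that by simp
  have base: "(cell (fst a, snd a), cell (i, j)) \<in> ?A" if ij: "cell (i, j) \<in> P" for i j
  proof -
    have b: "fst a \<le> i" "i < fst b" "snd a \<le> j" "j < snd b"
      and h: "i < fst a' \<or> fst b' \<le> i \<or> j < snd a' \<or> snd b' \<le> j"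
      using ij by (auto simp: iff)
    show ?thesis
    proof (cases "j < snd a' \<or> snd b' \<le> j \<or> i < fst a'")
      case True
      have "(cell (fst a, snd a), cell (fst a, j)) \<in> ?A"
        by (rule col) (use b assms in \<open>auto simp: iff\<close>)
      moreover have "(cell (fst a, j), cell (i, j)) \<in> ?A"
        by (rule row) (use b assms True in \<open>auto simp: iff\<close>)
      ultimately show ?thesis by (rule rtrancl_trans)
    next
      case False
      have "(cell (fst a, snd a), cell (i, snd a)) \<in> ?A"
        by (rule row) (use b assms in \<open>auto simp: iff\<close>)
      moreover have "(cell (i, snd a), cell (i, j)) \<in> ?A"
        by (rule col) (use b assms h False in \<open>auto simp: iff\<close>)
      ultimately show ?thesis by (rule rtrancl_trans)
    qed
  qed
  have from_base: "(cell (fst a, snd a), C) \<in> ?A" if "C \<in> P" for C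
  proof -
    obtain c where "C = cell c" using cells \<open>C \<in> P\<close> unfolding is_cell_def by blast
    then show ?thesis using base[of "fst c" "snd c"] \<open>C \<in> P\<close> by simp
  qed
  have "(C, D) \<in> ?A" if "C \<in> P" "D \<in> P" for C D
    by (rule rtrancl_trans[OF symD[OF from_base[OF that(1)]] from_base[OF that(2)]])
  then show ?thesis using fin cells unfolding polyomino_def P_def[symmetric] by blast
qed


section \<open>Existence and uniqueness of substitution homomorphisms\<close>

lemma poly_ring_simps [simp]:
  "p \<in> carrier (poly_ring V) \<longleftrightarrow> (\<forall>m\<in>Poly_Mapping.keys p. Poly_Mapping.keys m \<subseteq> V)"
  "monoid.mult (poly_ring V) = (*)" "one (poly_ring V) = 1"
  "ring.zero (poly_ring V) = 0" "add (poly_ring V) = (+)"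
  by (simp_all add: poly_ring_def)

lemma poly_ring_closed:
  assumes "p \<in> carrier (poly_ring V)" "q \<in> carrier (poly_ring V)"
  shows "p + q \<in> carrier (poly_ring V)" "p * q \<in> carrier (poly_ring V)"
    "- p \<in> carrier (poly_ring V)"
proof -
  show "p + q \<in> carrier (poly_ring V)"
    using assms Poly_Mapping.keys_add[of p q] by auto
  show "- p \<in> carrier (poly_ring V)"
    using assms by (auto simp: in_keys_iff)
  show "p * q \<in> carrier (poly_ring V)"
    unfolding poly_ring_simps
  proof
    fix m assume "m \<in> Poly_Mapping.keys (p * q)"
    then obtain m1 m2 where "m = m1 + m2" "m1 \<in> Poly_Mapping.keys p" "m2 \<in> Poly_Mapping.keys q"
      using keys_mult[of p q] by blast
    then show "Poly_Mapping.keys m \<subseteq> V"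
      using assms Poly_Mapping.keys_add[of m1 m2] by fastforce
  qed
qed

lemma scalar_closed: "scalar c \<in> carrier (poly_ring V)"
  by (simp add: scalar_def)

lemma one_closed: "1 \<in> carrier (poly_ring V)"
  using scalar_closed[of 1 V] by (simp add: scalar_def)

lemma zero_closed: "0 \<in> carrier (poly_ring V)"
  by simp

lemma indet_closed: "v \<in> V \<Longrightarrow> indet v \<in> carrier (poly_ring V)"
  by (simp add: indet_def)

lemma sum_closed:
  "(\<And>x. x \<in> A \<Longrightarrow> f x \<in> carrier (poly_ring V)) \<Longrightarrow> sum f A \<in> carrier (poly_ring V)"
  by (induction A rule: infinite_finite_induct)
     (simp_all add: poly_ring_closed zero_closed del: poly_ring_simps)

lemma power_closed: "p \<in> carrier (poly_ring V) \<Longrightarrow> p ^ n \<in> carrier (poly_ring V)"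
  by (induction n) (simp_all add: poly_ring_closed one_closed del: poly_ring_simps)

lemma prod_closed:
  "(\<And>x. x \<in> A \<Longrightarrow> f x \<in> carrier (poly_ring V)) \<Longrightarrow> prod f A \<in> carrier (poly_ring V)"
  by (induction A rule: infinite_finite_induct)
     (simp_all add: poly_ring_closed one_closed del: poly_ring_simps)

lemma cring_poly_ring: "cring (poly_ring V)"
proof (rule cringI)
  show "abelian_group (poly_ring V)"
  proof (rule abelian_groupI)
    fix p assume "p \<in> carrier (poly_ring V)"
    then show "\<exists>q\<in>carrier (poly_ring V). q \<oplus>\<^bsub>poly_ring V\<^esub> p = \<zero>\<^bsub>poly_ring V\<^esub>"
      by (intro bexI[of _ "- p"] poly_ring_closed) simp_all
  next
    show "p \<oplus>\<^bsub>poly_ring V\<^esub> q \<in> carrier (poly_ring V)"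
      if "p \<in> carrier (poly_ring V)" "q \<in> carrier (poly_ring V)" for p q
      unfolding poly_ring_simps(5) by (rule poly_ring_closed(1)[OF that])
  qed (simp_all add: add_ac)
  show "Group.comm_monoid (poly_ring V)"
  proof (rule comm_monoidI)
    show "p \<otimes>\<^bsub>poly_ring V\<^esub> q \<in> carrier (poly_ring V)"
      if "p \<in> carrier (poly_ring V)" "q \<in> carrier (poly_ring V)" for p q
      unfolding poly_ring_simps(2) by (rule poly_ring_closed(2)[OF that])
  qed (simp_all add: mult_ac)
qed (simp add: distrib_right)

definition monom_at :: "('v \<Rightarrow> ('w, 'k::comm_ring_1) mpoly) \<Rightarrow> ('v \<Rightarrow>\<^sub>0 nat) \<Rightarrow> ('w, 'k) mpoly" where
  "monom_at g m = (\<Prod>v\<in>Poly_Mapping.keys m. g v ^ Poly_Mapping.lookup m v)"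

definition subst :: "('v \<Rightarrow> ('w, 'k::comm_ring_1) mpoly) \<Rightarrow> ('v, 'k) mpoly \<Rightarrow> ('w, 'k) mpoly" where
  "subst g p = (\<Sum>m\<in>Poly_Mapping.keys p. scalar (Poly_Mapping.lookup p m) * monom_at g m)"

lemma monom_at_superset:
  assumes "finite A" "Poly_Mapping.keys m \<subseteq> A"
  shows "monom_at g m = (\<Prod>v\<in>A. g v ^ Poly_Mapping.lookup m v)"
  unfolding monom_at_def using assms
  by (intro prod.mono_neutral_left) (auto simp: in_keys_iff)

lemma monom_at_add: "monom_at g (m + n) = monom_at g m * monom_at g n"
proof -
  let ?A = "Poly_Mapping.keys m \<union> Poly_Mapping.keys n"
  have "monom_at g (m + n) = (\<Prod>v\<in>?A. g v ^ Poly_Mapping.lookup (m + n) v)"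
    by (rule monom_at_superset) (use Poly_Mapping.keys_add[of m n] in auto)
  also have "\<dots> = (\<Prod>v\<in>?A. g v ^ Poly_Mapping.lookup m v) * (\<Prod>v\<in>?A. g v ^ Poly_Mapping.lookup n v)"
    by (simp add: lookup_add power_add prod.distrib)
  also have "\<dots> = monom_at g m * monom_at g n"
    by (simp add: monom_at_superset[of ?A])
  finally show ?thesis .
qed

lemma scalar_simps:
  "scalar (c + d) = scalar c + scalar d" "scalar (c * d) = scalar c * scalar d"
  "scalar 0 = 0" "scalar 1 = 1"
  by (simp_all add: scalar_def Poly_Mapping.single_add mult_single)

lemma subst_superset:
  assumes "finite A" "Poly_Mapping.keys p \<subseteq> A"
  shows "subst g p = (\<Sum>m\<in>A. scalar (Poly_Mapping.lookup p m) * monom_at g m)"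
  unfolding subst_def using assms
  by (intro sum.mono_neutral_left) (auto simp: in_keys_iff scalar_simps)

lemma subst_add: "subst g (p + q) = subst g p + subst g q"
proof -
  let ?A = "Poly_Mapping.keys p \<union> Poly_Mapping.keys q"
  have "subst g (p + q) = (\<Sum>m\<in>?A. scalar (Poly_Mapping.lookup (p + q) m) * monom_at g m)"
    by (rule subst_superset) (use Poly_Mapping.keys_add[of p q] in auto)
  also have "\<dots> = subst g p + subst g q"
    by (simp add: lookup_add scalar_simps distrib_right sum.distrib subst_superset[of ?A])
  finally show ?thesis .
qed

lemma subst_0: "subst g 0 = 0"
  by (simp add: subst_def)

lemma subst_single: "subst g (Poly_Mapping.single m c) = scalar c * monom_at g m"
  by (cases "c = 0") (simp_all add: subst_def scalar_simps)

lemma subst_sum: "subst g (sum f A) = (\<Sum>x\<in>A. subst g (f x))"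
  by (induction A rule: infinite_finite_induct) (simp_all add: subst_0 subst_add)

lemma sum_singles:
  "p = (\<Sum>m\<in>Poly_Mapping.keys p. Poly_Mapping.single m (Poly_Mapping.lookup p m))"
  by (rule poly_mapping_eqI) (simp add: lookup_sum lookup_single when_def in_keys_iff)

lemma subst_mult: "subst g (p * q) = subst g p * subst g q"
proof -
  have "p * q = (\<Sum>m\<in>Poly_Mapping.keys p. \<Sum>n\<in>Poly_Mapping.keys q.
      Poly_Mapping.single (m + n) (Poly_Mapping.lookup p m * Poly_Mapping.lookup q n))"
    by (subst sum_singles[of p], subst sum_singles[of q]) (simp add: sum_product mult_single)
  then have "subst g (p * q) = (\<Sum>m\<in>Poly_Mapping.keys p. \<Sum>n\<in>Poly_Mapping.keys q.
      (scalar (Poly_Mapping.lookup p m) * monom_at g m) *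
      (scalar (Poly_Mapping.lookup q n) * monom_at g n))"
    by (simp add: subst_sum subst_single scalar_simps monom_at_add mult_ac)
  then show ?thesis by (simp add: subst_def sum_product)
qed

lemma subst_scalar: "subst g (scalar c) = scalar c"
proof -
  have "subst g (Poly_Mapping.single 0 c) = scalar c"
    by (simp add: subst_single monom_at_def)
  then show ?thesis by (simp add: scalar_def)
qed

lemma subst_indet: "subst g (indet v) = g v"
  by (simp add: indet_def subst_single monom_at_def scalar_simps)

lemma subst_algebra_hom:
  assumes "\<And>v. v \<in> V \<Longrightarrow> g v \<in> carrier (poly_ring W)"
  shows "subst g \<in> algebra_hom V W"
proof -
  have "subst g p \<in> carrier (poly_ring W)" if "p \<in> carrier (poly_ring V)" for p
    unfolding subst_def monom_at_def
    by (intro sum_closed poly_ring_closed scalar_closed prod_closed power_closed assms)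
       (use that in auto)
  then have "subst g \<in> ring_hom (poly_ring V) (poly_ring W)"
    by (intro ring_hom_memI)
       (simp_all add: subst_add subst_mult subst_scalar[of g 1, unfolded scalar_simps]
          del: poly_ring_simps(1))
  then show ?thesis by (simp add: algebra_hom_def subst_scalar)
qed

lemma single_eq_scalar_indets:
  "Poly_Mapping.single m c = scalar c * monom_at indet m"
proof -
  have pow: "indet v ^ n = (Poly_Mapping.single (Poly_Mapping.single v n) 1 :: ('a, 'b) mpoly)" for v n
    by (induction n) (simp_all add: indet_def mult_single Poly_Mapping.single_add[symmetric])
  have prod: "finite A \<Longrightarrow> (\<Prod>v\<in>A. (Poly_Mapping.single (h v) 1 :: ('a, 'b) mpoly))
      = Poly_Mapping.single (sum h A) 1" for h :: "'a \<Rightarrow> ('a \<Rightarrow>\<^sub>0 nat)" and A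
    by (induction A rule: finite_induct) (simp_all add: mult_single)
  have "monom_at indet m = (Poly_Mapping.single m 1 :: ('a, 'b) mpoly)"
    unfolding monom_at_def pow by (simp add: prod sum_singles[of m, symmetric])
  then show ?thesis by (simp add: scalar_def mult_single)
qed

lemma algebra_hom_eq_subst:
  assumes h: "h \<in> algebra_hom V W" and g: "\<And>v. v \<in> V \<Longrightarrow> h (indet v) = g v"
    and p: "p \<in> carrier (poly_ring V)"
  shows "h p = subst g p"
proof -
  let ?C = "carrier (poly_ring V)"
  have hom: "h \<in> ring_hom (poly_ring V) (poly_ring W)" and sc: "h (scalar c) = scalar c" for c
    using h by (auto simp: algebra_hom_def)
  have add: "h (x + y) = h x + h y" and mul: "h (x * y) = h x * h y" if "x \<in> ?C" "y \<in> ?C" for x y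
    using ring_hom_add[OF hom that] ring_hom_mult[OF hom that] by simp_all
  have one: "h 1 = 1" and zero: "h 0 = 0"
    using sc[of 1] sc[of 0] by (simp_all add: scalar_simps)
  have sum: "h (sum f A) = (\<Sum>x\<in>A. h (f x))" if "\<And>x. x \<in> A \<Longrightarrow> f x \<in> ?C" for f and A :: "('a \<Rightarrow>\<^sub>0 nat) set"
    using that by (induction A rule: infinite_finite_induct)
      (simp_all add: zero add sum_closed del: poly_ring_simps)
  have pow: "h (x ^ n) = h x ^ n" if "x \<in> ?C" for x n
    using that by (induction n) (simp_all add: one mul power_closed del: poly_ring_simps)
  have prod: "h (prod f A) = (\<Prod>x\<in>A. h (f x))" if "\<And>x. x \<in> A \<Longrightarrow> f x \<in> ?C" for f and A :: "'a set"
    using that by (induction A rule: infinite_finite_induct)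
      (simp_all add: one mul prod_closed del: poly_ring_simps)
  have V: "Poly_Mapping.keys m \<subseteq> V" if "m \<in> Poly_Mapping.keys p" for m
    using p that by simp
  have "monom_at indet m \<in> ?C \<and> h (monom_at indet m) = monom_at g m"
    if "m \<in> Poly_Mapping.keys p" for m
  proof
    have *: "indet v ^ n \<in> ?C" if "v \<in> Poly_Mapping.keys m" for v n
      using V[OF \<open>m \<in> _\<close>] that by (intro power_closed indet_closed) auto
    then show "monom_at indet m \<in> ?C"
      unfolding monom_at_def by (intro prod_closed)
    have "h (monom_at indet m) = (\<Prod>v\<in>Poly_Mapping.keys m. h (indet v ^ Poly_Mapping.lookup m v))"
      unfolding monom_at_def by (rule prod) (rule *)
    also have "\<dots> = monom_at g m"
      unfolding monom_at_def using V[OF that]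
      by (intro prod.cong) (auto simp: pow indet_closed g simp del: poly_ring_simps)
    finally show "h (monom_at indet m) = monom_at g m" .
  qed note mono = this
  have term_closed: "scalar c * monom_at indet m \<in> ?C" if "m \<in> Poly_Mapping.keys p" for m c
    using mono[OF that] by (intro poly_ring_closed scalar_closed) auto
  have "p = (\<Sum>m\<in>Poly_Mapping.keys p. scalar (Poly_Mapping.lookup p m) * monom_at indet m)"
    unfolding single_eq_scalar_indets[symmetric] by (rule sum_singles)
  then have "h p = h (\<Sum>m\<in>Poly_Mapping.keys p. scalar (Poly_Mapping.lookup p m) * monom_at indet m)"
    by (rule arg_cong)
  also have "\<dots> = (\<Sum>m\<in>Poly_Mapping.keys p. h (scalar (Poly_Mapping.lookup p m) * monom_at indet m))"
    by (rule sum) (rule term_closed)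
  also have "\<dots> = subst g p"
    unfolding subst_def
  proof (intro sum.cong refl)
    fix m assume "m \<in> Poly_Mapping.keys p"
    from mono[OF this] have m: "monom_at indet m \<in> ?C" "h (monom_at indet m) = monom_at g m"
      by blast+
    show "h (scalar (Poly_Mapping.lookup p m) * monom_at indet m) =
        scalar (Poly_Mapping.lookup p m) * monom_at g m"
      unfolding mul[OF scalar_closed m(1)] m(2) sc ..
  qed
  finally show ?thesis .
qed


section \<open>Well-definedness of the toric parametrisation\<close>

lemma vertex_set_ring_polyomino:
  assumes "fst a < fst a'" "fst a' < fst b'" "fst b' < fst b"
    and "snd a < snd a'" "snd a' < snd b'" "snd b' < snd b"
  shows "vertex_set (cells_in a b - cells_in a' b') =
    {v \<in> {a..b}. \<not> (fst a' < fst v \<and> fst v < fst b' \<and> snd a' < snd v \<and> snd v < snd b')}"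
    (is "?L = ?R")
proof
  show "?L \<subseteq> ?R"
  proof
    fix v assume "v \<in> ?L"
    then obtain i j where "cell (i, j) \<in> cells_in a b - cells_in a' b'" "v \<in> cell (i, j)"
      by (auto simp: vertex_set_def cell_vertices_eq)
    then show "v \<in> ?R"
      unfolding ring_polyomino_cell_iff using assms by (auto simp: cell_eq less_eq_prod_def)
  qed
  show "?R \<subseteq> ?L"
  proof
    fix v assume v: "v \<in> ?R"
    obtain x y where xy: "v = (x, y)" by (cases v)
    have step: "\<exists>i. p \<le> i \<and> i < q \<and> (t = i \<or> t = i + 1) \<and>
        (t \<le> p' \<longrightarrow> i < p') \<and> (q' \<le> t \<longrightarrow> q' \<le> i)"
      if "p < p'" "p' < q'" "q' < q" "p \<le> t" "t \<le> q" for p p' q' q t :: nat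
    proof (cases "t = p \<or> q' \<le> t \<and> t < q")
      case True
      then show ?thesis using that by (intro exI[of _ t]) linarith
    next
      case False
      then show ?thesis using that by (intro exI[of _ "t - 1"]) linarith
    qed
    have xb: "fst a \<le> x" "x \<le> fst b" "snd a \<le> y" "y \<le> snd b"
      and out: "x \<le> fst a' \<or> fst b' \<le> x \<or> y \<le> snd a' \<or> snd b' \<le> y"
      using v by (auto simp: xy less_eq_prod_def)
    obtain i where i: "fst a \<le> i" "i < fst b" "x = i \<or> x = i + 1"
      "x \<le> fst a' \<longrightarrow> i < fst a'" "fst b' \<le> x \<longrightarrow> fst b' \<le> i"
      using step[OF assms(1-3) xb(1,2)] by blast
    obtain j where j: "snd a \<le> j" "j < snd b" "y = j \<or> y = j + 1"
      "y \<le> snd a' \<longrightarrow> j < snd a'" "snd b' \<le> y \<longrightarrow> snd b' \<le> j"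
      using step[OF assms(4-6) xb(3,4)] by blast
    have "v \<in> cell (i, j)"
      using i(3) j(3) unfolding xy cell_eq by blast
    moreover have "cell (i, j) \<in> cells_in a b - cells_in a' b'"
      unfolding ring_polyomino_cell_iff using i j out by linarith
    ultimately show "v \<in> ?L" by (auto simp: vertex_set_def cell_vertices_eq)
  qed
qed

lemma label_pos:
  assumes "fst a < fst a'" "fst a' < fst b'" "fst b' < fst b"
    and "snd a < snd a'" "snd a' < snd b'" "snd b' < snd b"
    and "fst a \<le> fst v" "fst v \<le> fst b" "snd a \<le> snd v" "snd v \<le> snd b"
    and outside: "fst v \<le> fst a' \<or> fst b' \<le> fst v \<or> snd v \<le> snd a' \<or> snd b' \<le> snd v"
  shows "1 \<le> label a a' b' b v"
proof -
  consider "fst v \<le> fst a'" "snd v \<le> snd a'"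
    | "fst v \<le> fst a'" "snd a' < snd v" "snd v < snd b'"
    | "fst v \<le> fst a'" "snd b' \<le> snd v"
    | "fst a' < fst v" "fst v < fst b'" "snd v \<le> snd a'"
    | "fst a' < fst v" "fst v < fst b'" "snd b' \<le> snd v"
    | "fst b' \<le> fst v" "snd v \<le> snd a'"
    | "fst b' \<le> fst v" "snd a' < snd v" "snd v < snd b'"
    | "fst b' \<le> fst v" "snd b' \<le> snd v"
    using outside by linarith
  then show ?thesis
    using assms(1-10) unfolding label_def Let_def by cases simp_all
qed

lemma toric_hom_exists:
  assumes "fst a < fst a'" "fst a' < fst b'" "fst b' < fst b"
    and "snd a < snd a'" "snd a' < snd b'" "snd b' < snd b"
    and P: "P = cells_in a b - cells_in a' b'"
    and M: "M = Max (label a a' b' b ` vertex_set P)"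
  shows "\<exists>h :: (nat \<times> nat, 'k::comm_ring_1) mpoly \<Rightarrow> (toric_var, 'k) mpoly.
    h \<in> algebra_hom (vertex_set P) (toric_vars a b M) \<and>
    (\<forall>v\<in>vertex_set P. h (indet v) = indet (R (fst v)) * indet (S (snd v)) * indet (T (label a a' b' b v)))"
proof (intro exI conjI ballI)
  let ?g = "\<lambda>v. indet (R (fst v)) * indet (S (snd v)) * indet (T (label a a' b' b v))
    :: (toric_var, 'k) mpoly"
  note V = vertex_set_ring_polyomino[OF assms(1-6), folded P]
  have "finite (vertex_set P)"
  proof (rule finite_subset)
    show "vertex_set P \<subseteq> {fst a..fst b} \<times> {snd a..snd b}"
      unfolding V by (auto simp: less_eq_prod_def)
  qed simp
  then have "label a a' b' b v \<le> M" if "v \<in> vertex_set P" for v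
    unfolding M using that by simp
  moreover have "1 \<le> label a a' b' b v" if "v \<in> vertex_set P" for v
  proof -
    have "fst a \<le> fst v" "fst v \<le> fst b" "snd a \<le> snd v" "snd v \<le> snd b"
      "fst v \<le> fst a' \<or> fst b' \<le> fst v \<or> snd v \<le> snd a' \<or> snd b' \<le> snd v"
      using that unfolding V by (auto simp: less_eq_prod_def)
    then show ?thesis by (rule label_pos[OF assms(1-6)])
  qed
  ultimately show "subst ?g \<in> algebra_hom (vertex_set P) (toric_vars a b M)"
    by (intro subst_algebra_hom poly_ring_closed indet_closed)
       (auto simp: toric_vars_def V less_eq_prod_def)
  show "subst ?g (indet v) = ?g v" for v by (rule subst_indet)
qed

end

theory Submission
  imports Defs "HOL-Library.Multiset"
begin

text \<open>The kernel is spanned by the differences of monomials with the same image, so it suffices to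
  connect any two such monomials by inner minors. View monomials as multisets of lattice points. An
  inner minor exchanges the columns of two points lying in a common one of the four strips (left,
  right, bottom, top) around the hole. Labels and row and column counts determine the number of
  points in each corner and, away from the corners, the exact column (or row). Hence, if \<open>M\<close>
  and \<open>N\<close> have the same image and \<open>v\<close> is a point of \<open>N\<close>, then \<open>M\<close> has a point in the same zone as \<open>v\<close>; one
  move gives it the column of \<open>v\<close>, a second one the row of \<open>v\<close>. Now cancel \<open>v\<close> and induct.\<close>

section \<open>Monomials as multisets of indeterminates\<close>

text \<open>Encoding a monomial by the multiset of its indeterminates makes removing a point,
  exchanging points and comparing images plain multiset operations.\<close>

definition mset_monom :: "'v multiset \<Rightarrow> ('v, 'k::comm_ring_1) mpoly" where
  "mset_monom A = (\<Prod>v\<in>#A. indet v)"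

lemma mset_monom_empty [simp]: "mset_monom {#} = 1"
  by (simp add: mset_monom_def)

lemma mset_monom_add_mset [simp]: "mset_monom (add_mset v A) = indet v * mset_monom A"
  by (simp add: mset_monom_def)

lemma mset_monom_union [simp]: "mset_monom (A + B) = mset_monom A * mset_monom B"
  by (simp add: mset_monom_def)

lemma mset_monom_closed:
  "set_mset A \<subseteq> V \<Longrightarrow> mset_monom A \<in> carrier (poly_ring V)"
  by (induction A) (simp_all add: one_closed poly_ring_closed indet_closed del: poly_ring_simps(1))

definition exponent :: "'v multiset \<Rightarrow> 'v \<Rightarrow>\<^sub>0 nat" where
  "exponent A = (\<Sum>v\<in>#A. Poly_Mapping.single v 1)"

lemma lookup_exponent: "Poly_Mapping.lookup (exponent A) = count A"
  by (induction A) (auto simp: exponent_def lookup_add lookup_single when_def fun_eq_iff)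

lemma exponent_eq_iff: "exponent A = exponent B \<longleftrightarrow> A = B"
  by (metis lookup_exponent count_inject)

lemma mset_monom_eq_single: "mset_monom A = Poly_Mapping.single (exponent A) 1"
  by (induction A) (simp_all add: exponent_def indet_def mult_single)

definition exponent_mset :: "('v \<Rightarrow>\<^sub>0 nat) \<Rightarrow> 'v multiset" where
  "exponent_mset m = Abs_multiset (Poly_Mapping.lookup m)"

lemma count_exponent_mset: "count (exponent_mset m) = Poly_Mapping.lookup m"
  unfolding exponent_mset_def
  by (rule Abs_multiset_inverse) (use finite_lookup[of m] in simp)

lemma exponent_exponent_mset: "exponent (exponent_mset m) = m"
  by (rule poly_mapping_eqI) (simp add: lookup_exponent count_exponent_mset)

lemma set_exponent_mset: "set_mset (exponent_mset m) = Poly_Mapping.keys m"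
  by (auto simp: set_mset_def count_exponent_mset in_keys_iff)

lemma sum_mset_monoms:
  "p = (\<Sum>m\<in>Poly_Mapping.keys p. scalar (Poly_Mapping.lookup p m) * mset_monom (exponent_mset m))"
  by (simp add: mset_monom_eq_single exponent_exponent_mset scalar_def mult_single
      flip: sum_singles)

lemma lookup_scalar_mset_monom:
  "Poly_Mapping.lookup (scalar c * mset_monom A) (exponent B) = (if A = B then c else 0)"
  by (simp add: mset_monom_eq_single scalar_def mult_single lookup_single when_def exponent_eq_iff)

section \<open>Kernels of monomial homomorphisms\<close>

lemma algebra_hom_simps:
  assumes "h \<in> algebra_hom V W"
  shows "h (scalar c) = scalar c" "h 0 = 0" "h 1 = 1"
    and "p \<in> carrier (poly_ring V) \<Longrightarrow> q \<in> carrier (poly_ring V) \<Longrightarrow> h (p + q) = h p + h q"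
    and "p \<in> carrier (poly_ring V) \<Longrightarrow> q \<in> carrier (poly_ring V) \<Longrightarrow> h (p * q) = h p * h q"
    and "p \<in> carrier (poly_ring V) \<Longrightarrow> q \<in> carrier (poly_ring V) \<Longrightarrow> h (p - q) = h p - h q"
proof -
  have hom: "h \<in> ring_hom (poly_ring V) (poly_ring W)" and sc: "h (scalar c) = scalar c" for c
    using assms by (auto simp: algebra_hom_def)
  show "h (scalar c) = scalar c" "h 0 = 0" "h 1 = 1"
    using sc[of c] sc[of 0] sc[of 1] by (simp_all add: scalar_simps)
  have add: "h (p + q) = h p + h q" and mul: "h (p * q) = h p * h q"
    if "p \<in> carrier (poly_ring V)" "q \<in> carrier (poly_ring V)" for p q
    using ring_hom_add[OF hom that] ring_hom_mult[OF hom that] by simp_all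
  show "p \<in> carrier (poly_ring V) \<Longrightarrow> q \<in> carrier (poly_ring V) \<Longrightarrow> h (p + q) = h p + h q"
    "p \<in> carrier (poly_ring V) \<Longrightarrow> q \<in> carrier (poly_ring V) \<Longrightarrow> h (p * q) = h p * h q"
    by (rule add mul; assumption)+
  assume p: "p \<in> carrier (poly_ring V)" and q: "q \<in> carrier (poly_ring V)"
  have "h (p - q) + h q = h (p - q + q)"
    using add[OF poly_ring_closed(1)[OF p poly_ring_closed(3)[OF q q]] q] by simp
  then show "h (p - q) = h p - h q" by (simp add: algebra_simps)
qed

lemma algebra_hom_mset_monom:
  assumes h: "h \<in> algebra_hom V W" and \<epsilon>: "\<And>v. v \<in> V \<Longrightarrow> h (indet v) = mset_monom (\<epsilon> v)"
    and A: "set_mset A \<subseteq> V"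
  shows "h (mset_monom A) = mset_monom (\<Sum>v\<in>#A. \<epsilon> v)"
  using A
  by (induction A)
    (simp_all add: algebra_hom_simps[OF h] \<epsilon> indet_closed mset_monom_closed del: poly_ring_simps(1))

lemma algebra_hom_sum:
  assumes h: "h \<in> algebra_hom V W" and f: "\<And>x. x \<in> X \<Longrightarrow> f x \<in> carrier (poly_ring V)"
  shows "h (sum f X) = (\<Sum>x\<in>X. h (f x))"
  using f by (induction X rule: infinite_finite_induct)
    (simp_all add: algebra_hom_simps[OF h] sum_closed del: poly_ring_simps(1))

section \<open>Ideals of the polynomial ring\<close>

lemma poly_ring_ideal_closed:
  assumes "ideal I (poly_ring V)"
  shows "0 \<in> I" "p \<in> I \<Longrightarrow> q \<in> I \<Longrightarrow> p + q \<in> I"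
    "p \<in> carrier (poly_ring V) \<Longrightarrow> q \<in> I \<Longrightarrow> p * q \<in> I" "p \<in> I \<Longrightarrow> - p \<in> I"
proof -
  interpret ideal I "poly_ring V" by fact
  show "0 \<in> I" "p \<in> I \<Longrightarrow> q \<in> I \<Longrightarrow> p + q \<in> I"
    using additive_subgroup.zero_closed[OF is_additive_subgroup]
      additive_subgroup.a_closed[OF is_additive_subgroup] by simp_all
  show mul: "p * q \<in> I" if "p \<in> carrier (poly_ring V)" "q \<in> I" for p q
    using I_l_closed[OF that(2,1)] by simp
  show "p \<in> I \<Longrightarrow> - p \<in> I"
    using mul[OF poly_ring_closed(3)[OF one_closed one_closed], of p] by simp
qed

lemma poly_ring_ideal_sum:
  assumes "ideal I (poly_ring V)" and "\<And>x. x \<in> X \<Longrightarrow> f x \<in> I"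
  shows "sum f X \<in> I"
  using assms(2)
  by (induction X rule: infinite_finite_induct) (simp_all add: poly_ring_ideal_closed[OF assms(1)])

text \<open>Grouping the terms of an element of the kernel by the image of their monomials, the
  coefficients of each group add up to zero, so each group is a combination of differences of
  monomials with the same image.\<close>

lemma kernel_monomial_hom_subset:
  assumes h: "h \<in> algebra_hom V W" and \<epsilon>: "\<And>v. v \<in> V \<Longrightarrow> h (indet v) = mset_monom (\<epsilon> v)"
    and I: "ideal I (poly_ring V)"
    and fibres: "\<And>A B. set_mset A \<subseteq> V \<Longrightarrow> set_mset B \<subseteq> V \<Longrightarrow>
      (\<Sum>v\<in>#A. \<epsilon> v) = (\<Sum>v\<in>#B. \<epsilon> v) \<Longrightarrow> mset_monom A - mset_monom B \<in> I"
  shows "a_kernel (poly_ring V) (poly_ring W) h \<subseteq> I"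
proof
  fix p assume "p \<in> a_kernel (poly_ring V) (poly_ring W) h"
  then have p: "p \<in> carrier (poly_ring V)" and hp: "h p = 0"
    by (auto simp: a_kernel_def')
  define K where "K = Poly_Mapping.keys p"
  define c where "c = Poly_Mapping.lookup p"
  define image where "image m = (\<Sum>v\<in>#exponent_mset m. \<epsilon> v)" for m
  have fin: "finite K" by (simp add: K_def)
  have KV: "set_mset (exponent_mset m) \<subseteq> V" if "m \<in> K" for m
    using p that by (simp add: K_def set_exponent_mset)
  have p_eq: "p = (\<Sum>m\<in>K. scalar (c m) * mset_monom (exponent_mset m))"
    unfolding K_def c_def by (rule sum_mset_monoms)
  have "h p = (\<Sum>m\<in>K. h (scalar (c m) * mset_monom (exponent_mset m)))"
    unfolding p_eq
    by (rule algebra_hom_sum[OF h]) (intro poly_ring_closed scalar_closed mset_monom_closed KV)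
  also have "\<dots> = (\<Sum>m\<in>K. scalar (c m) * mset_monom (image m))"
    unfolding image_def
    by (intro sum.cong refl)
      (simp add: algebra_hom_simps[OF h] scalar_closed mset_monom_closed KV
        algebra_hom_mset_monom[OF h \<epsilon>] del: poly_ring_simps(1))
  finally have img: "(\<Sum>m\<in>K. scalar (c m) * mset_monom (image m)) = 0"
    using hp by simp
  \<comment> \<open>Compare coefficients of the monomial \<open>B\<close> on both sides of
    \<open>img\<close>.\<close>
  have coeff: "(\<Sum>m\<in>{m \<in> K. image m = B}. c m) = 0" for B
  proof -
    have "(\<Sum>m\<in>{m \<in> K. image m = B}. c m) =
        Poly_Mapping.lookup (\<Sum>m\<in>K. scalar (c m) * mset_monom (image m)) (exponent B)"
      by (simp add: lookup_sum lookup_scalar_mset_monom sum.inter_filter fin)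
    then show ?thesis by (simp add: img)
  qed
  \<comment> \<open>One monomial of \<open>K\<close> is chosen in each fibre; \<open>rep\<close> is
    only used at images of elements of \<open>K\<close>, where the choice exists.\<close>
  define rep where "rep B = (SOME m. m \<in> K \<and> image m = B)" for B
  have rep: "rep (image m) \<in> K \<and> image (rep (image m)) = image m" if "m \<in> K" for m
    unfolding rep_def by (rule someI[of _ m]) (use that in simp)
  have sum_scalar: "(\<Sum>m\<in>X. scalar (c m)) = scalar (sum c X)" for X
    by (induction X rule: infinite_finite_induct) (simp_all add: scalar_simps)
  \<comment> \<open>Replacing every monomial of \<open>p\<close> by the representative of its fibre
    gives zero, so this sum may be subtracted from \<open>p\<close> for free.\<close>
  have "(\<Sum>m\<in>K. scalar (c m) * mset_monom (exponent_mset (rep (image m)))) =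
      (\<Sum>B\<in>image ` K. \<Sum>m\<in>{m \<in> K. image m = B}.
        scalar (c m) * mset_monom (exponent_mset (rep (image m))))"
    by (rule sum.image_gen[OF fin])
  also have "\<dots> = (\<Sum>B\<in>image ` K.
      scalar (\<Sum>m\<in>{m \<in> K. image m = B}. c m) * mset_monom (exponent_mset (rep B)))"
    by (intro sum.cong refl) (simp add: sum_distrib_right flip: sum_scalar)
  also have "\<dots> = 0" by (simp add: coeff scalar_simps)
  finally have "p = (\<Sum>m\<in>K. scalar (c m) *
      (mset_monom (exponent_mset m) - mset_monom (exponent_mset (rep (image m)))))"
    using p_eq by (simp add: right_diff_distrib sum_subtractf)
  also have "\<dots> \<in> I"
  proof -
    have "scalar (c m) *
        (mset_monom (exponent_mset m) - mset_monom (exponent_mset (rep (image m)))) \<in> I"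
      if "m \<in> K" for m
      using rep[OF that] KV that
      by (intro poly_ring_ideal_closed(3)[OF I] scalar_closed fibres) (auto simp: image_def)
    then show ?thesis by (rule poly_ring_ideal_sum[OF I])
  qed
  finally show "p \<in> I" .
qed

section \<open>Moves inside the four strips\<close>

locale frame =
  fixes a a' b' b :: "nat \<times> nat"
  assumes bounds: "fst a < fst a'" "fst a' < fst b'" "fst b' < fst b"
    "snd a < snd a'" "snd a' < snd b'" "snd b' < snd b"
begin

abbreviation \<mu> :: "nat \<times> nat \<Rightarrow> int" where
  "\<mu> \<equiv> label a a' b' b"

definition cells :: "(nat \<times> nat) set set" where
  "cells = cells_in a b - cells_in a' b'"

definition V :: "(nat \<times> nat) set" where
  "V = vertex_set cells"

abbreviation I :: "(nat \<times> nat, 'k::comm_ring_1) mpoly set" where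
  "I \<equiv> polyomino_ideal cells"

text \<open>The sides of the hole, counted in cells; integers, because labels are.\<close>

definition width :: int where
  "width = int (fst b') - int (fst a')"

definition height :: int where
  "height = int (snd b') - int (snd a')"

definition toric_mset :: "nat \<times> nat \<Rightarrow> toric_var multiset" where
  "toric_mset v = {#R (fst v), S (snd v), T (\<mu> v)#}"

text \<open>The outer bounds of the left, right, bottom and top strips are left to membership in
  \<open>V\<close>.\<close>

definition same_strip :: "nat \<times> nat \<Rightarrow> nat \<times> nat \<Rightarrow> bool" where
  "same_strip v w \<longleftrightarrow> fst v \<le> fst a' \<and> fst w \<le> fst a' \<or> fst b' \<le> fst v \<and> fst b' \<le> fst w \<or>
     snd v \<le> snd a' \<and> snd w \<le> snd a' \<or> snd b' \<le> snd v \<and> snd b' \<le> snd w"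

section \<open>Vertices, rectangles and minors of the frame\<close>

lemma V_iff:
  "v \<in> V \<longleftrightarrow> fst a \<le> fst v \<and> fst v \<le> fst b \<and> snd a \<le> snd v \<and> snd v \<le> snd b \<and>
    (fst v \<le> fst a' \<or> fst b' \<le> fst v \<or> snd v \<le> snd a' \<or> snd b' \<le> snd v)"
  unfolding V_def cells_def vertex_set_ring_polyomino[OF bounds]
  by (auto simp: less_eq_prod_def not_less)

lemma cell_in_cells:
  "cell (i, j) \<in> cells \<longleftrightarrow> fst a \<le> i \<and> i < fst b \<and> snd a \<le> j \<and> j < snd b \<and>
     (i < fst a' \<or> fst b' \<le> i \<or> j < snd a' \<or> snd b' \<le> j)"
  unfolding cells_def ring_polyomino_cell_iff by auto

text \<open>A rectangle inside \<open>[a,b]\<close> avoids the cells of the hole exactly when it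
  lies within a single strip. This turns the condition on cells in an inner minor into one on two
  opposite corners.\<close>

lemma inner_rectangle_iff:
  assumes "i < k" "j < l"
  shows "(\<forall>r s. i \<le> r \<and> r \<le> k - 1 \<and> j \<le> s \<and> s \<le> l - 1 \<longrightarrow> cell (r, s) \<in> cells) \<longleftrightarrow>
    (i, j) \<in> V \<and> (k, l) \<in> V \<and> same_strip (i, j) (k, l)"
    (is "?L \<longleftrightarrow> ?R")
proof
  assume L: ?L
  have 1: "cell (i, j) \<in> cells"
    using assms by (intro L[rule_format]) auto
  have 2: "cell (k - 1, l - 1) \<in> cells"
    using assms by (intro L[rule_format]) auto
  have "same_strip (i, j) (k, l)"
  proof (rule ccontr)
    assume *: "\<not> same_strip (i, j) (k, l)"
    \<comment> \<open>The lower left cell of the overlap of the rectangle with the hole: it belongs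
      to both when no strip contains the rectangle.\<close>
    have "cell (max i (fst a'), max j (snd a')) \<in> cells"
      using assms * bounds by (intro L[rule_format]) (auto simp: same_strip_def)
    then show False
      using assms * bounds unfolding cell_in_cells same_strip_def by auto
  qed
  then show ?R using 1 2 assms unfolding V_iff cell_in_cells same_strip_def by auto
next
  assume ?R
  then show ?L using assms unfolding V_iff cell_in_cells same_strip_def by auto
qed

lemma inner_minors_cells:
  "inner_minors cells = {indet (i, j) * indet (k, l) - indet (i, l) * indet (k, j) | i j k l.
     i < k \<and> j < l \<and> (i, j) \<in> V \<and> (k, l) \<in> V \<and> same_strip (i, j) (k, l)}"
  unfolding inner_minors_def using inner_rectangle_iff by blast

lemma swap_in_V:
  assumes "(i, j) \<in> V" "(k, l) \<in> V" "same_strip (i, j) (k, l)"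
  shows "(i, l) \<in> V" "(k, j) \<in> V"
  using assms unfolding V_iff same_strip_def by auto

lemma inner_minors_closed: "inner_minors cells \<subseteq> carrier (poly_ring V)"
proof
  fix p :: "(nat \<times> nat, 'k::comm_ring_1) mpoly" assume "p \<in> inner_minors cells"
  then obtain i j k l where p: "p = indet (i, j) * indet (k, l) + - (indet (i, l) * indet (k, j))"
    and ij: "(i, j) \<in> V" "(k, l) \<in> V" "same_strip (i, j) (k, l)"
    unfolding inner_minors_cells by auto
  have *: "indet (i, l) * indet (k, j) \<in> carrier (poly_ring V)"
    by (intro poly_ring_closed indet_closed swap_in_V[OF ij])
  show "p \<in> carrier (poly_ring V)"
    unfolding p
    by (rule poly_ring_closed(1)[OF _ poly_ring_closed(3)[OF * *]])
      (intro poly_ring_closed indet_closed ij)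
qed

lemma ideal_I: "ideal I (poly_ring V)"
  unfolding polyomino_ideal_def V_def[symmetric]
  by (intro ring.genideal_ideal cring.axioms(1) cring_poly_ring inner_minors_closed)

text \<open>Frees the minors from the orientation \<open>i < k\<close>, \<open>j < l\<close>: a
  degenerate rectangle gives 0, and naming the corners in another order changes the binomial at most
  by a sign.\<close>

lemma minor_in_I:
  assumes "(i, j) \<in> V" "(k, l) \<in> V" "same_strip (i, j) (k, l)"
  shows "indet (i, j) * indet (k, l) - indet (i, l) * indet (k, j) \<in> I"
proof -
  have gen: "inner_minors cells \<subseteq> I"
    unfolding polyomino_ideal_def V_def[symmetric]
    by (intro ring.genideal_self cring.axioms(1) cring_poly_ring inner_minors_closed)
  have minor: "indet (i, j) * indet (k, l) - indet (i, l) * indet (k, j) \<in> I"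
    if "i < k" "j < l" "(i, j) \<in> V" "(k, l) \<in> V" "same_strip (i, j) (k, l)" for i j k l
    using gen that unfolding inner_minors_cells by blast
  have sym: "same_strip (k, l) (i, j)" "same_strip (i, l) (k, j)" "same_strip (k, j) (i, l)"
    using assms(3) by (auto simp: same_strip_def)
  note swap = swap_in_V[OF assms]
  note neg = poly_ring_ideal_closed(4)[OF ideal_I]
  consider "i = k" | "j = l" | "i < k" "j < l" | "k < i" "l < j" | "i < k" "l < j" | "k < i" "j < l"
    by linarith
  then show ?thesis
  proof cases
    case 4
    with minor[of k i l j] sym assms show ?thesis by (simp add: mult_ac)
  next
    case 5
    with neg[OF minor[of i k l j]] sym swap show ?thesis by (simp add: mult_ac)
  next
    case 6
    with neg[OF minor[of k i j l]] sym swap show ?thesis by (simp add: mult_ac)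
  qed (use minor assms poly_ring_ideal_closed(1)[OF ideal_I] in \<open>simp_all add: mult_ac\<close>)
qed

text \<open>Opposite corners share the label 1 or 2. Around the hole, the sections \<open>B\<close>,
  \<open>R\<close>, \<open>T\<close>, \<open>L\<close> use consecutive, possibly empty ranges that
  start at 3, \<open>width + 2\<close>, \<open>width + height + 1\<close> and
  \<open>2 * width + height\<close>. Hence a label of at least 3 determines the section and the
  column or row in it.\<close>

lemma label_cases:
  assumes "v \<in> V"
  obtains (LB) "fst v \<le> fst a'" "snd v \<le> snd a'" "\<mu> v = 1"
    | (RT) "fst b' \<le> fst v" "snd b' \<le> snd v" "\<mu> v = 1"
    | (LT) "fst v \<le> fst a'" "snd b' \<le> snd v" "\<mu> v = 2"
    | (RB) "fst b' \<le> fst v" "snd v \<le> snd a'" "\<mu> v = 2"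
    | (B) "fst a' < fst v" "fst v < fst b'" "snd v \<le> snd a'"
        "\<mu> v = int (fst v) - int (fst a') + 2"
    | (R) "fst b' \<le> fst v" "snd a' < snd v" "snd v < snd b'"
        "\<mu> v = int (snd v) - int (snd a') + width + 1"
    | (T) "fst a' < fst v" "fst v < fst b'" "snd b' \<le> snd v"
        "\<mu> v = int (fst b') - int (fst v) + width + height"
    | (L) "fst v \<le> fst a'" "snd a' < snd v" "snd v < snd b'"
        "\<mu> v = int (snd b') - int (snd v) + 2 * width + height - 1"
proof -
  have v: "fst a \<le> fst v" "fst v \<le> fst b" "snd a \<le> snd v" "snd v \<le> snd b"
    using assms by (simp_all add: V_iff)
  consider "fst v \<le> fst a'" "snd v \<le> snd a'"
    | "fst v \<le> fst a'" "snd a' < snd v" "snd v < snd b'"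
    | "fst v \<le> fst a'" "snd b' \<le> snd v"
    | "fst a' < fst v" "fst v < fst b'" "snd v \<le> snd a'"
    | "fst a' < fst v" "fst v < fst b'" "snd b' \<le> snd v"
    | "fst b' \<le> fst v" "snd v \<le> snd a'"
    | "fst b' \<le> fst v" "snd a' < snd v" "snd v < snd b'"
    | "fst b' \<le> fst v" "snd b' \<le> snd v"
    using assms unfolding V_iff by linarith
  then show thesis
  proof cases
    case 1
    then show thesis using v bounds by (intro LB) (simp_all add: label_def)
  next
    case 2
    then show thesis
      using v bounds by (intro L) (simp_all add: label_def width_def height_def)
  next
    case 3
    then show thesis using v bounds by (intro LT) (simp_all add: label_def)
  next
    case 4
    then show thesis using v bounds by (intro B) (simp_all add: label_def)
  next
    case 5
    then show thesis
      using v bounds by (intro T) (simp_all add: label_def width_def height_def)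
  next
    case 6
    then show thesis using v bounds by (intro RB) (simp_all add: label_def)
  next
    case 7
    then show thesis
      using v bounds by (intro R) (simp_all add: label_def width_def)
  next
    case 8
    then show thesis using v bounds by (intro RT) (simp_all add: label_def)
  qed
qed

lemma width_height_ge: "1 \<le> width" "1 \<le> height"
  using bounds by (simp_all add: width_def height_def)

text \<open>Labels are constant along columns within the bottom and top strips, and along rows
  within the left and right strips. So an exchange inside a strip preserves the two labels as a
  multiset.\<close>

lemma label_swap:
  assumes "(i, j) \<in> V" "(k, l) \<in> V" "same_strip (i, j) (k, l)"
  shows "\<mu> (i, j) = \<mu> (i, l) \<and> \<mu> (k, l) = \<mu> (k, j) \<or>
    \<mu> (i, j) = \<mu> (k, j) \<and> \<mu> (k, l) = \<mu> (i, l)"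
proof -
  have "\<mu> (i, j) = \<mu> (i, l)"
    if "j \<le> snd a' \<and> l \<le> snd a' \<or> snd b' \<le> j \<and> snd b' \<le> l" "(i, j) \<in> V" "(i, l) \<in> V" for i j l
    using that(1) bounds
    by (cases rule: label_cases[OF that(2)]; cases rule: label_cases[OF that(3)]; simp)
  moreover have "\<mu> (i, j) = \<mu> (k, j)"
    if "i \<le> fst a' \<and> k \<le> fst a' \<or> fst b' \<le> i \<and> fst b' \<le> k" "(i, j) \<in> V" "(k, j) \<in> V" for i j k
    using that(1) bounds
    by (cases rule: label_cases[OF that(2)]; cases rule: label_cases[OF that(3)]; simp)
  ultimately show ?thesis
    using assms swap_in_V[OF assms] unfolding same_strip_def fst_conv snd_conv by metis
qed

lemma toric_mset_swap:
  assumes "(i, j) \<in> V" "(k, l) \<in> V" "same_strip (i, j) (k, l)"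
  shows "toric_mset (i, j) + toric_mset (k, l) = toric_mset (i, l) + toric_mset (k, j)"
  using label_swap[OF assms] by (auto simp: toric_mset_def)

lemma swap_move:
  assumes M: "set_mset M \<subseteq> V" and w: "w \<in># M" and z: "z \<in># M" and strip: "same_strip w z"
  obtains M' where "set_mset M' \<subseteq> V" "(\<Sum>v\<in>#M'. toric_mset v) = (\<Sum>v\<in>#M. toric_mset v)"
    "mset_monom M - mset_monom M' \<in> (I :: (nat \<times> nat, 'k::comm_ring_1) mpoly set)"
    "(fst z, snd w) \<in># M'"
proof (cases "w = z")
  \<comment> \<open>\<open>M\<close> may contain this point only once, so no pair can be split off;
    nothing needs to move.\<close>
  case True
  show thesis
    by (rule that[of M]) (use True assms poly_ring_ideal_closed(1)[OF ideal_I] in auto)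
next
  case False
  obtain i j k l where eq: "w = (i, j)" "z = (k, l)" by fastforce
  from w obtain M1 where "M = add_mset w M1" by (metis insert_DiffM)
  with z False obtain A where A: "M = {#w, z#} + A"
    by (metis insert_DiffM insert_noteq_member add_mset_add_single union_commute
        union_mset_add_mset_left add_mset_commute empty_neutral(1))
  have wz: "(i, j) \<in> V" "(k, l) \<in> V" "same_strip (i, j) (k, l)"
    using assms by (auto simp: eq)
  let ?M' = "{#(i, l), (k, j)#} + A"
  show thesis
  proof (rule that[of ?M'])
    show "set_mset ?M' \<subseteq> V" using M swap_in_V[OF wz] by (simp add: A)
    show "(\<Sum>v\<in>#?M'. toric_mset v) = (\<Sum>v\<in>#M. toric_mset v)"
      using toric_mset_swap[OF wz] by (simp add: A eq add.assoc[symmetric])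
    have "mset_monom M - mset_monom ?M' =
        mset_monom A * (indet (i, j) * indet (k, l) - indet (i, l) * indet (k, j))"
      by (simp add: A eq algebra_simps)
    also have "\<dots> \<in> (I :: (nat \<times> nat, 'k) mpoly set)"
      by (intro poly_ring_ideal_closed(3)[OF ideal_I] mset_monom_closed minor_in_I wz)
        (use M in \<open>simp add: A\<close>)
    finally show "mset_monom M - mset_monom ?M' \<in> (I :: (nat \<times> nat, 'k) mpoly set)" .
    show "(fst z, snd w) \<in># ?M'" by (simp add: eq)
  qed
qed

section \<open>Connectedness of the fibres\<close>

text \<open>The variables \<open>R\<close>, \<open>S\<close> and \<open>T\<close> come from
  different constructors, so the image monomial records the columns, rows and labels
  separately.\<close>

lemma margins:
  assumes "(\<Sum>v\<in>#M. toric_mset v) = (\<Sum>v\<in>#N. toric_mset v)"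
  shows "image_mset fst M = image_mset fst N" "image_mset snd M = image_mset snd N"
    "image_mset \<mu> M = image_mset \<mu> N"
proof -
  have "count (image_mset fst A) x = count (\<Sum>v\<in>#A. toric_mset v) (R x)"
    "count (image_mset snd A) x = count (\<Sum>v\<in>#A. toric_mset v) (S x)"
    "count (image_mset \<mu> A) y = count (\<Sum>v\<in>#A. toric_mset v) (T y)" for A x y
    by (induction A) (auto simp: toric_mset_def)
  with assms show "image_mset fst M = image_mset fst N" "image_mset snd M = image_mset snd N"
    "image_mset \<mu> M = image_mset \<mu> N"
    by (simp_all add: multiset_eq_iff)
qed

text \<open>Twice the number of points in the corner common to two strips is the number of points in
  these strips, minus that in exactly one of them; the latter is determined by the labels, through \<open>L\<close>.\<close>

lemma corner_nonempty:
  assumes M: "set_mset M \<subseteq> V" and N: "set_mset N \<subseteq> V"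
    and eq: "(\<Sum>v\<in>#M. toric_mset v) = (\<Sum>v\<in>#N. toric_mset v)"
    and L: "\<And>v. v \<in> V \<Longrightarrow> L (\<mu> v) \<longleftrightarrow> X (fst v) \<noteq> Y (snd v)"
    and v: "v \<in># N" "X (fst v)" "Y (snd v)"
  shows "\<exists>w\<in>#M. X (fst w) \<and> Y (snd w)"
proof -
  have count: "size {#v \<in># A. X (fst v)#} + size {#v \<in># A. Y (snd v)#} =
      2 * size {#v \<in># A. X (fst v) \<and> Y (snd v)#} + size {#v \<in># A. L (\<mu> v)#}"
    if "set_mset A \<subseteq> V" for A
    using that by (induction A) (use L in auto)
  have cong: "size {#v \<in># M. Q (f v)#} = size {#v \<in># N. Q (f v)#}"
    if "image_mset f M = image_mset f N" for f :: "nat \<times> nat \<Rightarrow> 'z" and Q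
  proof -
    have "size {#v \<in># A. Q (f v)#} = size (filter_mset Q (image_mset f A))" for A
      by (simp add: filter_mset_image_mset o_def)
    then show ?thesis by (simp add: that)
  qed
  have "size {#v \<in># M. X (fst v) \<and> Y (snd v)#} = size {#v \<in># N. X (fst v) \<and> Y (snd v)#}"
    using count[OF M] count[OF N] cong[OF margins(1)[OF eq], of X]
      cong[OF margins(2)[OF eq], of Y] cong[OF margins(3)[OF eq], of L] by simp
  moreover have "v \<in># {#v \<in># N. X (fst v) \<and> Y (snd v)#}" using v by simp
  ultimately have "{#v \<in># M. X (fst v) \<and> Y (snd v)#} \<noteq> {#}"
    by (metis empty_not_add_mset multi_member_split size_eq_0_iff_empty)
  then obtain w where "w \<in># {#v \<in># M. X (fst v) \<and> Y (snd v)#}"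
    by (rule multiset_nonemptyE)
  then show ?thesis by auto
qed

text \<open>Coordinates that differ must lie on the same side of the hole. This is what allows a
  column or row to be changed by a move within one strip.\<close>

definition same_zone :: "nat \<times> nat \<Rightarrow> nat \<times> nat \<Rightarrow> bool" where
  "same_zone v w \<longleftrightarrow>
     (fst v = fst w \<or> fst v \<le> fst a' \<and> fst w \<le> fst a' \<or> fst b' \<le> fst v \<and> fst b' \<le> fst w) \<and>
     (snd v = snd w \<or> snd v \<le> snd a' \<and> snd w \<le> snd a' \<or> snd b' \<le> snd v \<and> snd b' \<le> snd w)"

text \<open>Away from the corners the label of \<open>v\<close> is at least 3, so \<open>w\<close>
  lies in the same section with the same column or row; the remaining coordinates lie on the same
  side of the hole.\<close>

lemma label_zone:
  assumes "v \<in> V" "w \<in> V" "\<mu> v = \<mu> w"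
    and "fst a' < fst v \<and> fst v < fst b' \<or> snd a' < snd v \<and> snd v < snd b'"
  shows "same_zone v w"
  using assms(3,4) bounds width_def height_def unfolding same_zone_def
  by (cases rule: label_cases[OF assms(1)]; cases rule: label_cases[OF assms(2)]; simp)

text \<open>Outside the corners any point of \<open>M\<close> with the label of \<open>v\<close>
  will do. At a corner the label cannot tell opposite corners apart, and points are counted
  instead.\<close>

lemma same_zone_member:
  assumes M: "set_mset M \<subseteq> V" and N: "set_mset N \<subseteq> V"
    and eq: "(\<Sum>v\<in>#M. toric_mset v) = (\<Sum>v\<in>#N. toric_mset v)" and v: "v \<in># N"
  shows "\<exists>w\<in>#M. same_zone v w"
proof -
  note corner = corner_nonempty[OF M N eq _ v]
  have vV: "v \<in> V" using v N by auto
  consider (mid) "fst a' < fst v \<and> fst v < fst b' \<or> snd a' < snd v \<and> snd v < snd b'"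
    | (LB) "fst v \<le> fst a'" "snd v \<le> snd a'" | (LT) "fst v \<le> fst a'" "snd b' \<le> snd v"
    | (RB) "fst b' \<le> fst v" "snd v \<le> snd a'" | (RT) "fst b' \<le> fst v" "snd b' \<le> snd v"
    by linarith
  then show ?thesis
  proof cases
    case mid
    have "\<mu> v \<in># image_mset \<mu> M"
      unfolding margins(3)[OF eq] using v by simp
    then obtain w where "w \<in># M" "\<mu> v = \<mu> w" by auto
    then show ?thesis using label_zone[OF vV _ _ mid] M by blast
  next
    case LB
    have "\<exists>w\<in>#M. fst w \<le> fst a' \<and> snd w \<le> snd a'"
    \<comment> \<open>\<open>L\<close> must select the points in exactly one of the left and bottom
      strips: the corners labelled 2 and the sections \<open>B\<close> and \<open>L\<close>.\<close>
    proof (rule corner[where L = "\<lambda>c. 2 \<le> c \<and> c \<le> width + 1 \<or> 2 * width + height \<le> c"])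
      fix u assume "u \<in> V"
      then show "(2 \<le> \<mu> u \<and> \<mu> u \<le> width + 1 \<or> 2 * width + height \<le> \<mu> u) \<longleftrightarrow>
          (fst u \<le> fst a') \<noteq> (snd u \<le> snd a')"
        using bounds width_height_ge
        by (cases rule: label_cases) (simp_all add: width_def height_def)
    qed (use LB in simp_all)
    then show ?thesis using LB by (auto simp: same_zone_def)
  next
    case LT
    have "\<exists>w\<in>#M. fst w \<le> fst a' \<and> snd b' \<le> snd w"
    \<comment> \<open>Exactly one of left and top: the corners labelled 1, then the ranges of
      \<open>T\<close> and \<open>L\<close>.\<close>
    proof (rule corner[where L = "\<lambda>c. c = 1 \<or> width + height < c"])
      fix u assume "u \<in> V"
      then show "(\<mu> u = 1 \<or> width + height < \<mu> u) \<longleftrightarrow>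
          (fst u \<le> fst a') \<noteq> (snd b' \<le> snd u)"
        using bounds width_height_ge
        by (cases rule: label_cases) (simp_all add: width_def height_def)
    qed (use LT in simp_all)
    then show ?thesis using LT by (auto simp: same_zone_def)
  next
    case RB
    have "\<exists>w\<in>#M. fst b' \<le> fst w \<and> snd w \<le> snd a'"
    \<comment> \<open>Exactly one of right and bottom: the corners labelled 1, then the ranges of
      \<open>B\<close> and \<open>R\<close>.\<close>
    proof (rule corner[where L = "\<lambda>c. c = 1 \<or> 3 \<le> c \<and> c \<le> width + height"])
      fix u assume "u \<in> V"
      then show "(\<mu> u = 1 \<or> 3 \<le> \<mu> u \<and> \<mu> u \<le> width + height) \<longleftrightarrow>
          (fst b' \<le> fst u) \<noteq> (snd u \<le> snd a')"
        using bounds width_height_ge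
        by (cases rule: label_cases) (simp_all add: width_def height_def)
    qed (use RB in simp_all)
    then show ?thesis using RB by (auto simp: same_zone_def)
  next
    case RT
    have "\<exists>w\<in>#M. fst b' \<le> fst w \<and> snd b' \<le> snd w"
    \<comment> \<open>Exactly one of right and top: the corners labelled 2, then the ranges of
      \<open>R\<close> and \<open>T\<close>.\<close>
    proof (rule corner[where L = "\<lambda>c. c = 2 \<or> width + 2 \<le> c \<and> c < 2 * width + height"])
      fix u assume "u \<in> V"
      then show "(\<mu> u = 2 \<or> width + 2 \<le> \<mu> u \<and> \<mu> u < 2 * width + height) \<longleftrightarrow>
          (fst b' \<le> fst u) \<noteq> (snd b' \<le> snd u)"
        using bounds width_height_ge
        by (cases rule: label_cases) (simp_all add: width_def height_def)
    qed (use RT in simp_all)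
    then show ?thesis using RT by (auto simp: same_zone_def)
  qed
qed

lemma move_to_member:
  assumes M: "set_mset M \<subseteq> V" and N: "set_mset N \<subseteq> V"
    and eq: "(\<Sum>v\<in>#M. toric_mset v) = (\<Sum>v\<in>#N. toric_mset v)" and v: "v \<in># N"
  obtains M' where "set_mset M' \<subseteq> V" "(\<Sum>v\<in>#M'. toric_mset v) = (\<Sum>v\<in>#M. toric_mset v)"
    "mset_monom M - mset_monom M' \<in> (I :: (nat \<times> nat, 'k::comm_ring_1) mpoly set)" "v \<in># M'"
proof -
  obtain w where w: "w \<in># M" "same_zone v w" using same_zone_member[OF assms] by blast
  have "fst v \<in># image_mset fst M" unfolding margins(1)[OF eq] using v by simp
  then obtain z where z: "z \<in># M" "fst z = fst v" by auto
  \<comment> \<open>If \<open>w\<close> is already in the column of \<open>v\<close>, it is its own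
    partner, since \<open>z\<close> need not share a strip with it. Otherwise the columns of
    \<open>w\<close> and \<open>v\<close> are on one side of the hole, so \<open>w\<close> and
    \<open>z\<close> share the left or right strip.\<close>
  define z1 where "z1 = (if fst w = fst v then w else z)"
  have z1: "z1 \<in># M" "fst z1 = fst v" using w z by (auto simp: z1_def)
  have "same_strip w z1 \<or> w = z1"
    using w z by (auto simp: z1_def same_zone_def same_strip_def)
  then obtain M1 where M1: "set_mset M1 \<subseteq> V"
      "(\<Sum>v\<in>#M1. toric_mset v) = (\<Sum>v\<in>#M. toric_mset v)"
      "mset_monom M - mset_monom M1 \<in> (I :: (nat \<times> nat, 'k) mpoly set)"
      "(fst v, snd w) \<in># M1"
    using swap_move[OF M w(1) z1(1)] z1(2) w(1) M poly_ring_ideal_closed(1)[OF ideal_I]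
    by (metis cancel_comm_monoid_add_class.diff_cancel prod.collapse)
  \<comment> \<open>The first move keeps the image, so \<open>M1\<close> still has a point
    \<open>y\<close> in the row of \<open>v\<close>.\<close>
  note eq1 = M1(2)[unfolded eq]
  have "snd v \<in># image_mset snd M1" unfolding margins(2)[OF eq1] using v by simp
  then obtain y where y: "y \<in># M1" "snd y = snd v" by auto
  show thesis
  proof (cases "snd w = snd v")
    case True
    then show thesis using that[OF M1(1-3)] M1(4) by simp
  next
    case False
    \<comment> \<open>The rows of \<open>v\<close> and \<open>w\<close> differ, so both are at the
      bottom or both at the top; exchanging columns with \<open>y\<close> then creates
      \<open>v\<close>.\<close>
    then have "same_strip y (fst v, snd w)"
      using w y by (auto simp: same_zone_def same_strip_def)
    then obtain M2 where M2: "set_mset M2 \<subseteq> V"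
        "(\<Sum>v\<in>#M2. toric_mset v) = (\<Sum>v\<in>#M1. toric_mset v)"
        "mset_monom M1 - mset_monom M2 \<in> (I :: (nat \<times> nat, 'k) mpoly set)" "v \<in># M2"
      using swap_move[OF M1(1) y(1) M1(4)] y(2) by (metis fst_conv prod.collapse)
    have "mset_monom M - mset_monom M2 \<in> (I :: (nat \<times> nat, 'k) mpoly set)"
      using poly_ring_ideal_closed(2)[OF ideal_I M1(3) M2(3)] by simp
    then show thesis using that M2 M1(2) by metis
  qed
qed

lemma fibre_connected:
  assumes "set_mset M \<subseteq> V" "set_mset N \<subseteq> V"
    and "(\<Sum>v\<in>#M. toric_mset v) = (\<Sum>v\<in>#N. toric_mset v)"
  shows "mset_monom M - mset_monom N \<in> (I :: (nat \<times> nat, 'k::comm_ring_1) mpoly set)"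
  using assms
proof (induction N arbitrary: M)
  case empty
  \<comment> \<open>The column multiset has as many entries as there are points.\<close>
  then have "M = {#}" using margins(1)[of M "{#}"] by simp
  then show ?case using poly_ring_ideal_closed(1)[OF ideal_I] by simp
next
  case (add v N)
  obtain M' where M': "set_mset M' \<subseteq> V" "(\<Sum>v\<in>#M'. toric_mset v) = (\<Sum>v\<in>#M. toric_mset v)"
      "mset_monom M - mset_monom M' \<in> (I :: (nat \<times> nat, 'k) mpoly set)" "v \<in># M'"
    by (rule move_to_member[OF add.prems, of v]) simp_all
  then obtain A where A: "M' = add_mset v A" by (metis multi_member_split)
  have "mset_monom A - mset_monom N \<in> (I :: (nat \<times> nat, 'k) mpoly set)"
    using M'(1,2) add.prems by (intro add.IH) (simp_all add: A)
  then have "indet v * (mset_monom A - mset_monom N) \<in> (I :: (nat \<times> nat, 'k) mpoly set)"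
    using add.prems by (intro poly_ring_ideal_closed(3)[OF ideal_I] indet_closed) simp
  \<comment> \<open>In the sum of the two members of \<open>I\<close> the terms
    \<open>mset_monom M'\<close> cancel, because \<open>M'\<close> is
    \<open>add_mset v A\<close>.\<close>
  from poly_ring_ideal_closed(2)[OF ideal_I M'(3) this] show ?case
    by (simp add: A right_diff_distrib)
qed

section \<open>The polyomino ideal as the kernel of the toric homomorphism\<close>

lemma inner_minors_kernel:
  fixes h :: "(nat \<times> nat, 'k::comm_ring_1) mpoly \<Rightarrow> (toric_var, 'k) mpoly"
  assumes h: "h \<in> algebra_hom V W"
    and \<epsilon>: "\<And>v. v \<in> V \<Longrightarrow> h (indet v) = mset_monom (toric_mset v)"
  shows "inner_minors cells \<subseteq> a_kernel (poly_ring V) (poly_ring W) h"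
proof
  fix p :: "(nat \<times> nat, 'k) mpoly" assume p: "p \<in> inner_minors cells"
  then obtain i j k l where p_eq: "p = mset_monom {#(i, j), (k, l)#} - mset_monom {#(i, l), (k, j)#}"
    and ij: "(i, j) \<in> V" "(k, l) \<in> V" "same_strip (i, j) (k, l)"
    unfolding inner_minors_cells by auto
  note swap = swap_in_V[OF ij]
  have sets: "set_mset {#(i, j), (k, l)#} \<subseteq> V" "set_mset {#(i, l), (k, j)#} \<subseteq> V"
    using ij swap by simp_all
  have "h p = mset_monom (\<Sum>v\<in>#{#(i, j), (k, l)#}. toric_mset v) -
      mset_monom (\<Sum>v\<in>#{#(i, l), (k, j)#}. toric_mset v)"
    unfolding p_eq algebra_hom_simps(6)[OF h sets[THEN mset_monom_closed]]
    using algebra_hom_mset_monom[OF h \<epsilon>] sets by metis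
  also have "\<dots> = 0" using toric_mset_swap[OF ij] by simp
  finally show "p \<in> a_kernel (poly_ring V) (poly_ring W) h"
    using subsetD[OF inner_minors_closed p] by (simp add: a_kernel_def' del: poly_ring_simps(1))
qed

text \<open>The kernel is an ideal containing the generators of \<open>I\<close>; conversely,
  connected fibres put the kernel inside \<open>I\<close>. The target variables \<open>W\<close>
  stay arbitrary, since only the images of the indeterminates matter.\<close>

lemma polyomino_ideal_eq_kernel:
  fixes h :: "(nat \<times> nat, 'k::comm_ring_1) mpoly \<Rightarrow> (toric_var, 'k) mpoly"
  assumes h: "h \<in> algebra_hom V W"
    and \<epsilon>: "\<And>v. v \<in> V \<Longrightarrow> h (indet v) = mset_monom (toric_mset v)"
  shows "I = a_kernel (poly_ring V) (poly_ring W) h"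
proof
  have "ring_hom_ring (poly_ring V) (poly_ring W) h"
    using h by (intro ring_hom_ringI2 cring.axioms(1) cring_poly_ring) (simp add: algebra_hom_def)
  then have "ideal (a_kernel (poly_ring V) (poly_ring W) h) (poly_ring V)"
    by (rule ring_hom_ring.kernel_is_ideal)
  then show "I \<subseteq> a_kernel (poly_ring V) (poly_ring W) h"
    unfolding polyomino_ideal_def V_def[symmetric]
    by (intro ring.genideal_minimal cring.axioms(1) cring_poly_ring inner_minors_kernel[OF h \<epsilon>])
  show "a_kernel (poly_ring V) (poly_ring W) h \<subseteq> I"
    by (rule kernel_monomial_hom_subset[OF h \<epsilon> ideal_I fibre_connected])
qed

end

theorem theorem1p1:
  fixes a a' b' b :: "nat \<times> nat"
    and P :: "(nat \<times> nat) set set"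
    and M :: int
    and \<phi> :: "(nat \<times> nat, 'k::field) mpoly \<Rightarrow> (toric_var, 'k) mpoly"
  assumes "fst a < fst a'" and "fst a' < fst b'" and "fst b' < fst b"
    and "snd a < snd a'" and "snd a' < snd b'" and "snd b' < snd b"
    and "P = cells_in a b - cells_in a' b'"
    and "M = Max (label a a' b' b ` vertex_set P)"
    and "\<phi> \<in> algebra_hom (vertex_set P) (toric_vars a b M)"
    and "\<forall>v\<in>vertex_set P.
           \<phi> (indet v) = indet (R (fst v)) * indet (S (snd v)) * indet (T (label a a' b' b v))"
  shows "polyomino_ideal P =
           a_kernel (poly_ring (vertex_set P)) (poly_ring (toric_vars a b M)) \<phi>"
proof -
  interpret frame a a' b' b using assms(1-6) by unfold_locales
  have P: "P = cells" and V: "vertex_set P = V"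
    using assms(7) by (simp_all add: cells_def V_def)
  show ?thesis
    \<comment> \<open>The order matters: rewriting \<open>P\<close> first would destroy the instance
      of \<open>vertex_set P\<close> that \<open>V\<close> rewrites.\<close>
    unfolding V unfolding P
  proof (rule polyomino_ideal_eq_kernel)
    show "\<phi> \<in> algebra_hom V (toric_vars a b M)" using assms(9) by (simp only: V)
    show "\<phi> (indet v) = mset_monom (toric_mset v)" if "v \<in> V" for v
      using assms(10) that by (simp add: V toric_mset_def mult.assoc)
  qed
qed

end
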